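(* Let $\mathcal{F}_1$ be the family of all lines in $\mathbb{R}^2$ and let $\mathcal{F}_2=\{l_1\cup l_2 : l_1,l_2\in\mathcal{F}_1\}$. Then $\mathsf{VC}\text{-}\mathsf{dim}(\mathcal{F}_2)=5$, i.e. there is a $5$-element subset of $\mathbb{R}^2$ shattered by $\mathcal{F}_2$, and no $6$-element subset of $\mathbb{R}^2$ is shattered by $\mathcal{F}_2$.
   Context: A family $\mathcal{S}$ of subsets of $X$ shatters $Y\subseteq X$ if for every $Z\subseteq Y$ there is $S\in\mathcal{S}$ with $S\cap Y=Z$. The VC-dimension $\mathsf{VC}\text{-}\mathsf{dim}(\mathcal{S})$ is the largest $n$ such that some $Y\subseteq X$ with $|Y|=n$ is shattered by $\mathcal{S}$. Here $X=\mathbb{R}^2$. *)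

theory Defs
  imports "HOL-Analysis.Analysis" "HOL-Library.Extended_Nat"
begin

text \<open>The ground set $X$ is the universe of the type \<open>'a\<close>.\<close>

definition shatters :: "'a set set \<Rightarrow> 'a set \<Rightarrow> bool" where
  "shatters \<S> Y \<longleftrightarrow> (\<forall>Z. Z \<subseteq> Y \<longrightarrow> (\<exists>S\<in>\<S>. S \<inter> Y = Z))"

text \<open>The supremum is taken in \<^typ>\<open>enat\<close>, so that the value is \<open>\<infinity>\<close> if arbitrarily large
  finite sets are shattered; for a nonempty family it is otherwise the largest size of a
  shattered set.\<close>

definition VC_dim :: "'a set set \<Rightarrow> enat" where
  "VC_dim \<S> = Sup {enat n | n. \<exists>Y. finite Y \<and> card Y = n \<and> shatters \<S> Y}"

definition plane_lines :: "(real ^ 2) set set" where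
  "plane_lines = {l. affine l \<and> aff_dim l = 1}"

text \<open>The two lines may coincide, so every single line is also a member.\<close>

definition line_pairs :: "(real ^ 2) set set" where
  "line_pairs = {l1 \<union> l2 | l1 l2. l1 \<in> plane_lines \<and> l2 \<in> plane_lines}"

end

theory Submission
  imports Defs
begin

text \<open>
  Distinct lines share at most one point, so three collinear points inside a union of two lines
  force one of these to be the line carrying them. Hence, if a set \<open>Y\<close> is shattered, no line
  contains four of its points: three of them could not be separated from the fourth. If moreover
  \<open>Y\<close> has six points, then covering \<open>Y\<close> splits it into two disjoint collinear triples on lines
  \<open>l1\<close>, \<open>l2\<close>, and covering \<open>Y\<close> minus a point of \<open>l1\<close> forces one line to be \<open>l2\<close> and then the
  other to be \<open>l1\<close>, which contains the omitted point. Conversely, three collinear points together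
  with two points such that there is no further collinear triple form a shattered set.
\<close>

lemma shatters_subset:
  assumes "shatters \<S> Y" "X \<subseteq> Y"
  shows "shatters \<S> X"
  unfolding shatters_def
proof (intro allI impI)
  fix Z assume "Z \<subseteq> X"
  with assms obtain S where "S \<in> \<S>" "S \<inter> Y = Z"
    unfolding shatters_def by (meson subset_trans)
  then show "\<exists>S\<in>\<S>. S \<inter> X = Z"
    using \<open>Z \<subseteq> X\<close> \<open>X \<subseteq> Y\<close> by blast
qed

lemma shatters_line_pairsE:
  assumes "shatters line_pairs Y" "Z \<subseteq> Y"
  obtains m1 m2 where "m1 \<in> plane_lines" "m2 \<in> plane_lines" "(m1 \<union> m2) \<inter> Y = Z"
  using assms unfolding shatters_def line_pairs_def by blast

text \<open>The affine hull of \<open>{a, b}\<close> is one-dimensional and lies in every line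
  through both points, so it equals each of \<open>l\<close> and \<open>m\<close>.\<close>

lemma plane_lines_eqI:
  assumes "l \<in> plane_lines" "m \<in> plane_lines" "a \<in> l \<inter> m" "b \<in> l \<inter> m" "a \<noteq> b"
  shows "l = m"
proof -
  have "affine hull {a, b} = k" if "k \<in> plane_lines" "a \<in> k" "b \<in> k" for k
    using that \<open>a \<noteq> b\<close>
    by (intro affine_dim_equal) (auto simp: plane_lines_def hull_minimal)
  then show ?thesis
    using assms by blast
qed

text \<open>A line other than \<open>l\<close> meets \<open>W\<close> in at most one point, so two
  such lines cover at most two points of \<open>W\<close>.\<close>

lemma plane_lines_three_points:
  assumes "l \<in> plane_lines" "m1 \<in> plane_lines" "m2 \<in> plane_lines"
    and "W \<subseteq> l" "W \<subseteq> m1 \<union> m2" "3 \<le> card W"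
  shows "m1 = l \<or> m2 = l"
proof (rule ccontr)
  assume neither: "\<not> ?thesis"
  have "card (W \<inter> m) \<le> 1" if "m \<in> plane_lines" "m \<noteq> l" for m
  proof -
    have "x = y" if "x \<in> W \<inter> m" "y \<in> W \<inter> m" for x y
      using plane_lines_eqI[of l m x y] that \<open>m \<in> plane_lines\<close> \<open>m \<noteq> l\<close> assms by blast
    then show ?thesis
      by (metis One_nat_def card_le_Suc0_iff_eq card.infinite zero_le)
  qed
  then have "card (W \<inter> m1) \<le> 1" "card (W \<inter> m2) \<le> 1"
    using assms neither by blast+
  moreover have "W = (W \<inter> m1) \<union> (W \<inter> m2)"
    using assms by blast
  then have "card W \<le> card (W \<inter> m1) + card (W \<inter> m2)"
    by (metis card_Un_le)
  ultimately show False
    using assms by linarith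
qed

lemma shattered_line_card_le_3:
  assumes "shatters line_pairs Y" "l \<in> plane_lines"
  shows "card (l \<inter> Y) \<le> 3"
proof (rule ccontr)
  assume gt: "\<not> ?thesis"
  then obtain W where W: "W \<subseteq> l \<inter> Y" "card W = 3"
    by (metis linorder_le_cases obtain_subset_with_card_n)
  then obtain d where d: "d \<in> l \<inter> Y" "d \<notin> W"
    using gt by (metis order_refl subsetI subset_antisym)
  obtain m1 m2 where m: "m1 \<in> plane_lines" "m2 \<in> plane_lines" "(m1 \<union> m2) \<inter> Y = W"
    using shatters_line_pairsE[OF assms(1), of W] W by blast
  then have "m1 = l \<or> m2 = l"
    using assms(2) W by (intro plane_lines_three_points[of l m1 m2 W]) auto
  then show False
    using m d by blast
qed

lemma not_shatters_line_pairs_6: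
  assumes "card Y = 6"
  shows "\<not> shatters line_pairs Y"
proof
  assume sh: "shatters line_pairs Y"
  have [simp]: "finite Y"
    using assms by (auto intro: card_ge_0_finite)
  obtain l1 l2 where l: "l1 \<in> plane_lines" "l2 \<in> plane_lines" "(l1 \<union> l2) \<inter> Y = Y"
    using shatters_line_pairsE[OF sh, of Y] by blast
  have "(l1 \<inter> Y) \<union> (l2 \<inter> Y) = Y"
    using l by blast
  \<comment> \<open>Inclusion-exclusion: with both summands at most 3, equality must hold in each
    and the intersection must be empty.\<close>
  then have "card (l1 \<inter> Y) + card (l2 \<inter> Y) = 6 + card ((l1 \<inter> Y) \<inter> (l2 \<inter> Y))"
    using card_Un_Int[of "l1 \<inter> Y" "l2 \<inter> Y"] assms by simp
  moreover have "card (l1 \<inter> Y) \<le> 3" "card (l2 \<inter> Y) \<le> 3"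
    using shattered_line_card_le_3[OF sh] l by blast+
  ultimately have c: "card (l1 \<inter> Y) = 3" "card (l2 \<inter> Y) = 3"
    and "card ((l1 \<inter> Y) \<inter> (l2 \<inter> Y)) = 0"
    by linarith+
  then have disj: "(l1 \<inter> Y) \<inter> (l2 \<inter> Y) = {}"
    by simp
  obtain a b c where abc: "l1 \<inter> Y = {a, b, c}" "a \<noteq> b" "b \<noteq> c" "a \<noteq> c"
    using c(1) by (auto simp: card_3_iff)
  obtain m1 m2 where m: "m1 \<in> plane_lines" "m2 \<in> plane_lines" "(m1 \<union> m2) \<inter> Y = Y - {a}"
    using shatters_line_pairsE[OF sh, of "Y - {a}"] by blast
  \<comment> \<open>Disjointness keeps \<open>b\<close> and \<open>c\<close> off \<open>l2\<close>,
    so \<open>k\<close> has to pass through both; then \<open>k = l1\<close>, which contains the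
    excluded \<open>a\<close>.\<close>
  have other: False if "k \<in> plane_lines" "(l2 \<union> k) \<inter> Y = Y - {a}" for k
  proof -
    have "b \<in> k" "c \<in> k" "a \<notin> k" "a \<in> l1" "b \<in> l1" "c \<in> l1"
      using that abc disj by blast+
    then show False
      using plane_lines_eqI[of l1 k b c] l that abc by blast
  qed
  have "l2 \<inter> Y \<subseteq> m1 \<union> m2"
    using m disj abc by blast
  then have "m1 = l2 \<or> m2 = l2"
    using plane_lines_three_points[of l2 m1 m2 "l2 \<inter> Y"] l m c by simp
  then show False
    using other m by (metis Un_commute)
qed

text \<open>The set is the hyperplane with normal vector \<open>(p, q)\<close>, and hyperplanes of
  the plane have dimension 1.\<close>

lemma plane_line_equation:
  assumes "p \<noteq> 0 \<or> q \<noteq> 0"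
  shows "{v :: real ^ 2. p * v $ 1 + q * v $ 2 = r} \<in> plane_lines"
proof -
  have "vector [p, q] \<noteq> (0 :: real ^ 2)"
    using assms by (auto simp: vec_eq_iff forall_2)
  moreover have "{v :: real ^ 2. p * v $ 1 + q * v $ 2 = r} = {v. vector [p, q] \<bullet> v = r}"
    by (auto simp: inner_vec_def sum_2)
  ultimately show ?thesis
    by (simp add: plane_lines_def affine_hyperplane aff_dim_hyperplane)
qed

lemma shatters_line_pairs_5:
  "\<exists>Y. card Y = 5 \<and> shatters line_pairs Y"
proof -
  define pt :: "real \<Rightarrow> real \<Rightarrow> real ^ 2" where "pt x y = vector [x, y]" for x y
  have pt_nth [simp]: "pt x y $ 1 = x" "pt x y $ 2 = y" for x y
    by (simp_all add: pt_def)
  have pt_eq [simp]: "pt x y = pt x' y' \<longleftrightarrow> x = x' \<and> y = y'" for x y x' y'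
    by (metis pt_nth)
  \<comment> \<open>The line through \<open>b1\<close> and \<open>b2\<close> meets the horizontal
    axis at \<open>-1\<close>, hence in none of the \<open>a\<close>-points.\<close>
  define a1 a2 a3 b1 b2
    where pts: "a1 = pt 0 0" "a2 = pt 1 0" "a3 = pt 2 0" "b1 = pt 0 1" "b2 = pt 1 2"
  define Y where "Y = {a1, a2, a3, b1, b2}"
  \<comment> \<open>\<open>tr T\<close> says that a single line cuts out exactly \<open>T\<close>
    from \<open>Y\<close>.\<close>
  define tr where "tr T \<longleftrightarrow> (\<exists>l\<in>plane_lines. l \<inter> Y = T)" for T
  have trI: "tr T" if "p \<noteq> 0 \<or> q \<noteq> 0" "{v. p * v $ 1 + q * v $ 2 = r} \<inter> Y = T" for p q r T
    unfolding tr_def using plane_line_equation that by blast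
  \<comment> \<open>The form \<open>x + 3 y\<close> takes distinct values at the five points.\<close>
  have "tr {}" by (rule trI[of 1 3 "-1"]) (auto simp: Y_def pts)
  moreover have "tr {a1}" by (rule trI[of 1 3 0]) (auto simp: Y_def pts)
  moreover have "tr {a2}" by (rule trI[of 1 3 1]) (auto simp: Y_def pts)
  moreover have "tr {a3}" by (rule trI[of 1 3 2]) (auto simp: Y_def pts)
  moreover have "tr {b1}" by (rule trI[of 1 3 3]) (auto simp: Y_def pts)
  moreover have "tr {b2}" by (rule trI[of 1 3 7]) (auto simp: Y_def pts)
  moreover have "tr {a1, b1}" by (rule trI[of 1 0 0]) (auto simp: Y_def pts)
  moreover have "tr {a2, b1}" by (rule trI[of 1 1 1]) (auto simp: Y_def pts)
  moreover have "tr {a3, b1}" by (rule trI[of 1 2 2]) (auto simp: Y_def pts)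
  moreover have "tr {a1, b2}" by (rule trI[of 2 "-1" 0]) (auto simp: Y_def pts)
  moreover have "tr {a2, b2}" by (rule trI[of 1 0 1]) (auto simp: Y_def pts)
  moreover have "tr {a3, b2}" by (rule trI[of 2 1 4]) (auto simp: Y_def pts)
  moreover have "tr {b1, b2}" by (rule trI[of 1 "-1" "-1"]) (auto simp: Y_def pts)
  moreover have "tr {a1, a2, a3}" by (rule trI[of 0 1 0]) (auto simp: Y_def pts)
  ultimately have
    bb: "\<And>B. B \<in> {{}, {b1}, {b2}, {b1, b2}} \<Longrightarrow> tr B"
    and ab: "\<And>a B. a \<in> {a1, a2, a3} \<Longrightarrow> B \<in> {{}, {b1}, {b2}} \<Longrightarrow> tr (insert a B)"
    and aa: "\<And>A. A \<in> {{}, {a1}, {a2}, {a3}, {a1, a2, a3}} \<Longrightarrow> tr A"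
    by auto
  have "\<exists>T U. tr T \<and> tr U \<and> T \<union> U = Z" if "Z \<subseteq> Y" for Z
  proof -
    define A B where "A = Z \<inter> {a1, a2, a3}" and "B = Z \<inter> {b1, b2}"
    have Z: "Z = A \<union> B"
      using that by (auto simp: A_def B_def Y_def)
    have B: "B \<in> {{}, {b1}, {b2}, {b1, b2}}"
      unfolding B_def by blast
    \<comment> \<open>If \<open>A\<close> does not have two elements, one line can cut out
      \<open>A\<close> and the other \<open>B\<close>. A line through two of the
      \<open>a\<close>-points contains the third, so pairs need another split.\<close>
    have "A \<in> {{}, {a1}, {a2}, {a3}, {a1, a2, a3}} \<or> A \<in> {{a1, a2}, {a1, a3}, {a2, a3}}"
      unfolding A_def by (cases "a1 \<in> Z"; cases "a2 \<in> Z"; cases "a3 \<in> Z") simp_all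
    then show ?thesis
    proof
      assume "A \<in> {{}, {a1}, {a2}, {a3}, {a1, a2, a3}}"
      then have "tr A" by (rule aa)
      moreover have "tr B" using B by (rule bb)
      ultimately show ?thesis using Z by blast
    next
      assume "A \<in> {{a1, a2}, {a1, a3}, {a2, a3}}"
      then obtain x y where xy: "A = {x, y}" "x \<in> {a1, a2, a3}" "y \<in> {a1, a2, a3}"
        by blast
      \<comment> \<open>The two lines separate \<open>x\<close> from \<open>y\<close>; the first
        also takes \<open>b1\<close> and the second \<open>b2\<close>, whenever these lie in
        \<open>Z\<close>.\<close>
      have "tr (insert x (B \<inter> {b1}))" "tr (insert y (B \<inter> {b2}))"
        using xy by (auto intro!: ab)
      moreover have "insert x (B \<inter> {b1}) \<union> insert y (B \<inter> {b2}) = Z"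
        using Z xy(1) B by auto
      ultimately show ?thesis by blast
    qed
  qed
  then have "\<exists>S\<in>line_pairs. S \<inter> Y = Z" if "Z \<subseteq> Y" for Z
    using that unfolding line_pairs_def tr_def by (smt (verit) Int_Un_distrib2 mem_Collect_eq)
  then have "shatters line_pairs Y"
    unfolding shatters_def by blast
  moreover have "card Y = 5"
    by (simp add: Y_def pts)
  ultimately show ?thesis by blast
qed

theorem corollary5p3:
  shows "VC_dim line_pairs = 5
    \<and> (\<exists>Y :: (real ^ 2) set. card Y = 5 \<and> shatters line_pairs Y)
    \<and> \<not> (\<exists>Y :: (real ^ 2) set. card Y = 6 \<and> shatters line_pairs Y)"
proof (intro conjI)
  obtain Y :: "(real ^ 2) set" where Y: "card Y = 5" "shatters line_pairs Y"
    using shatters_line_pairs_5 by blast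
  \<comment> \<open>A larger shattered set would have a six-element subset, again shattered.\<close>
  have le: "n \<le> 5" if "card X = n" "shatters line_pairs X" for n and X :: "(real ^ 2) set"
  proof (rule ccontr)
    assume "\<not> n \<le> 5"
    with that have "6 \<le> card X"
      by linarith
    then obtain W where "W \<subseteq> X" "card W = 6"
      by (rule obtain_subset_with_card_n)
    then show False
      using that shatters_subset not_shatters_line_pairs_6 by blast
  qed
  have "finite Y"
    using Y by (auto intro: card_ge_0_finite)
  have "VC_dim line_pairs = enat 5"
    unfolding VC_dim_def
  proof (rule antisym)
    show "Sup {enat n |n. \<exists>Y. finite Y \<and> card Y = n \<and> shatters line_pairs Y} \<le> enat 5"
      using le by (intro Sup_least) auto
    show "enat 5 \<le> Sup {enat n |n. \<exists>Y. finite Y \<and> card Y = n \<and> shatters line_pairs Y}"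
      using Y \<open>finite Y\<close> by (intro Sup_upper) blast
  qed
  then show "VC_dim line_pairs = 5"
    by (simp add: numeral_eq_enat)
qed (use shatters_line_pairs_5 not_shatters_line_pairs_6 in blast)+

end
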